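(* There is an absolute constant $c>0$ such that the following holds. Let $n\ge1$, $k\ge 2$, and let $\nu$ be a probability distribution on $[k]$. Let $\Pi$ be a deterministic $[c_1,\ldots,c_k]$-bounded $k$-party protocol which solves unique set-disjointness under input distribution $\mathcal{D}_\nu$ with error at most $2\%$. Then $$\sum_{i\in[k]}\frac{c_i}{\nu(i)}\ \ge\ c\,n,$$ with the conventions $0/0=0$ and $a/0=+\infty$ for $a>0$.
   Context: Inputs are $X=(X_1,\ldots,X_k)\in(\{0,1\}^n)^k$, player $i$ holding $X_i$; $X^j=(X_1(j),\ldots,X_k(j))$ and $|X^j|$ is its Hamming weight. $\mathcal{F}_0=\{X:\forall j,\ |X^j|\le1\}$, $\mathcal{F}_1=\{X:\exists j,\ |X^j|=k,\ \forall j'\ne j,\ |X^{j'}|\le 1\}$; the correct output on $\mathcal{F}_b$ is $b$. Protocols are in the blackboard model (at each step a player determined by the current transcript writes a bit depending on its input and the transcript; the output bit is determined by the transcript). A protocol is $[c_1,\ldots,c_k]$-bounded if in every transcript player $i$ writes at most $c_i$ bits. It solves the problem under an input distribution $\mu$ (a distribution over pairs $(b,X)$ with $X\in\mathcal{F}_b$) with error $\delta$ if its output equals $b$ with probability at least $1-\delta$. Distribution $\mathcal{D}^0_\nu$: sample $W\in[k]^n$ with i.i.d. coordinates $W_j\sim\nu$; for each $j$, if $W_j=i$ then $X_i(j)\in\{0,1\}$ is a uniform bit and $X_{i'}(j)=0$ for $i'\ne i$. Distribution $\mathcal{D}^1_\nu$: sample $X\sim\mathcal{D}^0_\nu$, a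 uniform $j^*\in[n]$, and replace column $X^{j^*}$ by $1^k$. $\mathcal{D}_\nu$: sample a uniform bit $b$ and $X\sim\mathcal{D}^b_\nu$. *)

theory Defs
  imports "HOL-Probability.Probability"
begin

text \<open>Inputs: X i j is the bit X_i(j); players i < k, coordinates j < n.
  A well-shaped input is False outside these ranges.\<close>
type_synonym input = "nat \<Rightarrow> nat \<Rightarrow> bool"

definition well_shaped :: "nat \<Rightarrow> nat \<Rightarrow> input \<Rightarrow> bool" where
  "well_shaped k n X \<longleftrightarrow> (\<forall>i j. (k \<le> i \<or> n \<le> j) \<longrightarrow> \<not> X i j)"

text \<open>Deterministic blackboard protocols as (finite) protocol trees.
  At a node Node i f p0 p1, player i writes the bit f X_i (which may depend on
  the transcript so far via the position in the tree) and the protocol continues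
  with p1 if the bit is True, p0 otherwise. A leaf carries the output bit.\<close>
datatype protocol = Leaf bool | Node nat "(nat \<Rightarrow> bool) \<Rightarrow> bool" protocol protocol

fun valid_players :: "nat \<Rightarrow> protocol \<Rightarrow> bool" where
  "valid_players k (Leaf b) = True"
| "valid_players k (Node i f p0 p1) = (i < k \<and> valid_players k p0 \<and> valid_players k p1)"

fun run_output :: "protocol \<Rightarrow> input \<Rightarrow> bool" where
  "run_output (Leaf b) X = b"
| "run_output (Node i f p0 p1) X = (if f (X i) then run_output p1 X else run_output p0 X)"

fun bits_written :: "nat \<Rightarrow> protocol \<Rightarrow> input \<Rightarrow> nat" where
  "bits_written m (Leaf b) X = 0"
| "bits_written m (Node i f p0 p1) X =
     (if i = m then 1 else 0) + (if f (X i) then bits_written m p1 X else bits_written m p0 X)"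

definition protocol_bounded :: "nat \<Rightarrow> nat \<Rightarrow> (nat \<Rightarrow> nat) \<Rightarrow> protocol \<Rightarrow> bool" where
  "protocol_bounded k n c P \<longleftrightarrow> valid_players k P \<and>
     (\<forall>X. well_shaped k n X \<longrightarrow> (\<forall>i<k. bits_written i P X \<le> c i))"

definition D0 :: "nat \<Rightarrow> nat pmf \<Rightarrow> input pmf" where
  "D0 n \<nu> = map_pmf (\<lambda>WB. \<lambda>i j. j < n \<and> fst (WB j) = i \<and> snd (WB j))
      (Pi_pmf {0..<n} (0, False) (\<lambda>_. pair_pmf \<nu> (pmf_of_set (UNIV :: bool set))))"

definition D1 :: "nat \<Rightarrow> nat \<Rightarrow> nat pmf \<Rightarrow> input pmf" where
  "D1 k n \<nu> = do {
      X \<leftarrow> D0 n \<nu>;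
      jstar \<leftarrow> pmf_of_set {0..<n};
      return_pmf (\<lambda>i j. if j = jstar then i < k else X i j) }"

definition D :: "nat \<Rightarrow> nat \<Rightarrow> nat pmf \<Rightarrow> (bool \<times> input) pmf" where
  "D k n \<nu> = do {
      b \<leftarrow> pmf_of_set (UNIV :: bool set);
      X \<leftarrow> (if b then D1 k n \<nu> else D0 n \<nu>);
      return_pmf (b, X) }"

definition error_prob :: "nat \<Rightarrow> nat \<Rightarrow> nat pmf \<Rightarrow> protocol \<Rightarrow> real" where
  "error_prob k n \<nu> P = measure_pmf.prob (D k n \<nu>) {(b, X). run_output P X \<noteq> b}"

definition ratio :: "nat \<Rightarrow> real \<Rightarrow> ennreal" where
  "ratio a p = (if p = 0 then (if a = 0 then 0 else \<infinity>) else ennreal (real a / p))"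

end

theory Submission
  imports Defs
begin

text \<open>
  Fix the vector \<open>w\<close> of column owners (distributed as \<open>W\<close>) and let \<open>Q\<^sub>A\<close> be the
  distribution of the transcript when column \<open>j\<close> is planted with ones exactly for the players in \<open>A\<close>
  and the other columns stay random. Three estimates on the squared Hellinger distance \<open>H\<^sup>2\<close>
  are combined.

  (1) For fixed \<open>w\<close>, the transcript depends on the input of player \<open>i\<close> through at most \<open>2^c\<^sub>i\<close>
  outcomes, so an exponential moment bound (in place of the usual entropy argument) shows that
  \<open>H\<^sup>2(Q\<^sub>\<emptyset>, Q\<^bsub>{i}\<^esub>)\<close> summed over the columns \<open>j\<close> with \<open>w j = i\<close> is at most \<open>4 c\<^sub>i\<close>.
  This distance does not depend on \<open>w j\<close>, so averaging over \<open>w\<close> bounds the sum over all columns by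
  \<open>4 c\<^sub>i / \<nu>(i)\<close>.

  (2) The rectangle property gives \<open>H(Q\<^sub>\<emptyset>, Q\<^bsub>A \<union> B\<^esub>) = H(Q\<^sub>A, Q\<^sub>B)\<close> for disjoint \<open>A\<close>, \<open>B\<close>.
  Repeatedly merging the cheapest pair of blocks of players yields
  \<open>H\<^sup>2(Q\<^sub>\<emptyset>, Q\<^bsub>[k]\<^esub>) \<le> e\<^sup>2 (\<Sum>i. H\<^sup>2(Q\<^sub>\<emptyset>, Q\<^bsub>{i}\<^esub>))\<close>
  with no dependence on \<open>k\<close>.

  (3) A small error forces \<open>H\<^sup>2(Q\<^sub>\<emptyset>, Q\<^bsub>[k]\<^esub>)\<close> to be at least 1 on average over \<open>w\<close> and \<open>j\<close>.
\<close>

section \<open>Transcripts\<close>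

text \<open>The output bit is appended, so that it can be read off the transcript.\<close>
fun transcript :: "protocol \<Rightarrow> input \<Rightarrow> bool list" where
  "transcript (Leaf b) X = [b]"
| "transcript (Node i f p0 p1) X =
     f (X i) # (if f (X i) then transcript p1 X else transcript p0 X)"

lemma transcript_nonempty [simp]: "transcript P X \<noteq> []"
  by (cases P) auto

lemma last_transcript: "last (transcript P X) = run_output P X"
  by (induction P) auto

lemma finite_range_transcript: "finite (range (transcript P))"
proof (induction P)
  case (Leaf b)
  then show ?case by (simp add: image_def)
next
  case (Node i f p0 p1)
  have "range (transcript (Node i f p0 p1)) \<subseteq>
      (#) True ` range (transcript p1) \<union> (#) False ` range (transcript p0)"
    by auto
  then show ?case
    by (rule finite_subset) (use Node in auto)
qed

text \<open>Both runs follow the same path, so at each of its nodes the bits computed from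
  \<open>X i\<close> and \<open>Y i\<close> agree.\<close>

lemma transcript_cut_paste:
  assumes "transcript P X = l" "transcript P Y = l"
  shows "transcript P (\<lambda>i. if i \<in> A then X i else Y i) = l"
  using assms by (induction P arbitrary: l) (auto split: if_splits)

text \<open>With the other inputs fixed, runs branch only at nodes of player \<open>i\<close>. Such
  a node spends one bit of the budget and at most doubles the count.\<close>

lemma card_transcripts_le:
  assumes "\<And>x. x \<in> U \<Longrightarrow> bits_written i P (X(i := x)) \<le> c"
  shows "card ((\<lambda>x. transcript P (X(i := x))) ` U) \<le> 2 ^ c"
  using assms
proof (induction P arbitrary: U c)
  case (Leaf b)
  have "(\<lambda>x. transcript (Leaf b) (X(i := x))) ` U \<subseteq> {[b]}" by auto
  then have "card ((\<lambda>x. transcript (Leaf b) (X(i := x))) ` U) \<le> 1"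
    using card_mono[of "{[b]}"] by fastforce
  also have "1 \<le> (2::nat) ^ c" by simp
  finally show ?case .
next
  case (Node m f p0 p1)
  let ?t = "\<lambda>P x. transcript P (X(i := x))"
  show ?case
  proof (cases "m = i")
    case False
    then have eq: "?t (Node m f p0 p1) x = f (X m) # ?t (if f (X m) then p1 else p0) x" for x
      by simp
    have "card (?t (if f (X m) then p1 else p0) ` U) \<le> 2 ^ c"
    proof (cases "f (X m)")
      case True
      have "card (?t p1 ` U) \<le> 2 ^ c"
        by (rule Node.IH(2)) (use Node.prems True False in force)
      then show ?thesis using True by simp
    next
      case F: False
      have "card (?t p0 ` U) \<le> 2 ^ c"
        by (rule Node.IH(1)) (use Node.prems F False in force)
      then show ?thesis using F by simp
    qed
    moreover have "?t (Node m f p0 p1) ` U = (#) (f (X m)) ` ?t (if f (X m) then p1 else p0) ` U"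
      unfolding eq image_image ..
    moreover have "card ((#) (f (X m)) ` ?t (if f (X m) then p1 else p0) ` U)
        = card (?t (if f (X m) then p1 else p0) ` U)"
      by (rule card_image) auto
    ultimately show ?thesis by (simp only:)
  next
    case True
    \<comment> \<open>Each subtree is reached only by the inputs that wrote the matching bit; for
      these its remaining budget is one less.\<close>
    define U1 U0 where "U1 = {x\<in>U. f x}" and "U0 = {x\<in>U. \<not> f x}"
    have img: "?t (Node m f p0 p1) ` U = (#) True ` ?t p1 ` U1 \<union> (#) False ` ?t p0 ` U0"
    proof -
      have "U = U1 \<union> U0" by (auto simp: U1_def U0_def)
      moreover have "?t (Node m f p0 p1) ` U1 = (#) True ` ?t p1 ` U1"
        unfolding image_image by (intro image_cong refl) (simp add: True U1_def)
      moreover have "?t (Node m f p0 p1) ` U0 = (#) False ` ?t p0 ` U0"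
        unfolding image_image by (intro image_cong refl) (simp add: True U0_def)
      ultimately show ?thesis by (simp only: image_Un)
    qed
    have b1: "Suc (bits_written i p1 (X(i := x))) \<le> c" if "x \<in> U1" for x
      using Node.prems[of x] that True by (simp add: U1_def fun_upd_def)
    have b0: "Suc (bits_written i p0 (X(i := x))) \<le> c" if "x \<in> U0" for x
      using Node.prems[of x] that True by (simp add: U0_def fun_upd_def)
    show ?thesis
    proof (cases c)
      case 0
      then have "U1 = {}" "U0 = {}" using b1 b0 by auto
      then show ?thesis unfolding img by simp
    next
      case (Suc d)
      have "card (?t p1 ` U1) \<le> 2 ^ d" by (rule Node.IH(2)) (use b1 Suc in \<open>auto simp: fun_upd_def\<close>)
      moreover have "card (?t p0 ` U0) \<le> 2 ^ d" by (rule Node.IH(1)) (use b0 Suc in \<open>auto simp: fun_upd_def\<close>)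
      moreover have "card (?t (Node m f p0 p1) ` U)
          \<le> card ((#) True ` ?t p1 ` U1) + card ((#) False ` ?t p0 ` U0)"
        unfolding img by (rule card_Un_le)
      moreover have "card ((#) True ` ?t p1 ` U1) = card (?t p1 ` U1)"
        "card ((#) False ` ?t p0 ` U0) = card (?t p0 ` U0)"
        by (auto intro!: card_image)
      ultimately show ?thesis unfolding Suc power_Suc mult_2 by linarith
    qed
  qed
qed

section \<open>Merging blocks of players\<close>

text \<open>Centring at \<open>z\<close> with \<open>h A = z - f A\<close>, the two sides differ by
  exactly \<open>2 * (\<Sum>A\<in>F. h A)\<^sup>2\<close>.\<close>

lemma sum_pairs_sq_le:
  fixes f :: "'b \<Rightarrow> real"
  assumes "finite F"
  shows "(\<Sum>A\<in>F. \<Sum>B\<in>F. (f A - f B)\<^sup>2) \<le> 2 * card F * (\<Sum>A\<in>F. (z - f A)\<^sup>2)"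
proof -
  define h where "h A = z - f A" for A
  have "(\<Sum>A\<in>F. \<Sum>B\<in>F. (f A - f B)\<^sup>2) = (\<Sum>A\<in>F. \<Sum>B\<in>F. (h A)\<^sup>2 + (h B)\<^sup>2 - 2 * (h A * h B))"
    by (intro sum.cong refl) (simp add: h_def power2_eq_square algebra_simps)
  also have "\<dots> = 2 * card F * (\<Sum>A\<in>F. (h A)\<^sup>2) - 2 * (\<Sum>A\<in>F. h A)\<^sup>2"
    by (simp add: sum.distrib sum_subtractf sum_distrib_left[symmetric] sum_product[symmetric]
        power2_eq_square sum_distrib_right[symmetric])
  also have "\<dots> \<le> 2 * card F * (\<Sum>A\<in>F. (h A)\<^sup>2)" by simp
  finally show ?thesis by (simp add: h_def)
qed

lemma exists_pair_le_average:
  fixes \<Phi> :: "'b \<Rightarrow> 'b \<Rightarrow> real"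
  assumes "finite F" "card F \<ge> 2"
    and "(\<Sum>A\<in>F. \<Sum>B\<in>F - {A}. \<Phi> A B) \<le> real (card F) * (real (card F) - 1) * t"
  shows "\<exists>A\<in>F. \<exists>B\<in>F. A \<noteq> B \<and> \<Phi> A B \<le> t"
proof (rule ccontr)
  assume "\<not> ?thesis"
  then have gt: "t < \<Phi> A B" if "A \<in> F" "B \<in> F - {A}" for A B
    using that by (metis Diff_iff singleton_iff not_le)
  have ne: "F \<noteq> {}" "F - {A} \<noteq> {}" if "A \<in> F" for A
    using assms(2) that card_mono[of "{A}" F] by auto
  have "(\<Sum>A\<in>F. \<Sum>B\<in>F - {A}. t) < (\<Sum>A\<in>F. \<Sum>B\<in>F - {A}. \<Phi> A B)"
    using assms(1,2) ne gt by (intro sum_strict_mono) auto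
  also have "(\<Sum>A\<in>F. \<Sum>B\<in>F - {A}. t) = real (card F) * (real (card F) - 1) * t"
    using assms(1,2) by (simp add: of_nat_diff)
  finally show False using assms(3) by simp
qed

text \<open>
  Merging a suitable pair among \<open>m\<close> disjoint blocks increases the sum of \<open>g\<close> over the blocks by a
  factor of at most \<open>1 + 2/(m(m-1))\<close>; the product of these factors telescopes inside the
  exponential.
\<close>
lemma merge_blocks:
  fixes g :: "'a set \<Rightarrow> real" and F :: "'a set set"
  assumes pair: "\<And>F. \<lbrakk>finite F; pairwise disjnt F; {} \<notin> F\<rbrakk> \<Longrightarrow>
      (\<Sum>A\<in>F. \<Sum>B\<in>F - {A}. g (A \<union> B)) \<le> 2 * card F * (\<Sum>A\<in>F. g A)"
    and nonneg: "\<And>A. g A \<ge> 0"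
    and F: "finite F" "F \<noteq> {}" "pairwise disjnt F" "{} \<notin> F"
  shows "g (\<Union>F) \<le> exp (2 - 2 / card F) * (\<Sum>A\<in>F. g A)"
  using F
proof (induction "card F" arbitrary: F)
  case 0
  then show ?case by simp
next
  case (Suc m')
  define m where "m = real (card F)"
  define s where "s = (\<Sum>A\<in>F. g A)"
  have s0: "s \<ge> 0" unfolding s_def by (intro sum_nonneg nonneg)
  show ?case
  proof (cases "card F = 1")
    case True
    then obtain A where "F = {A}" by (auto simp: card_1_singleton_iff)
    then show ?thesis by simp
  next
    case False
    then have m2: "card F \<ge> 2" using Suc.hyps by linarith
    then have m2': "m \<ge> 2" by (simp add: m_def)
    \<comment> \<open>The summand is the block sum after merging \<open>A\<close> and
      \<open>B\<close>. Its average over ordered pairs bounds the cheapest merge.\<close>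
    have "(\<Sum>A\<in>F. \<Sum>B\<in>F - {A}. s - g A - g B + g (A \<union> B))
        = m * (m - 1) * s - 2 * (m - 1) * s + (\<Sum>A\<in>F. \<Sum>B\<in>F - {A}. g (A \<union> B))"
    proof -
      have c: "real (card (F - {A})) = m - 1" if "A \<in> F" for A
        using that Suc.prems(1) m2 by (simp add: m_def of_nat_diff)
      have a: "(\<Sum>B\<in>F - {A}. s - g A - g B) = (m - 1) * (s - g A) - (s - g A)" if "A \<in> F" for A
      proof -
        have "(\<Sum>B\<in>F - {A}. s - g A - g B) = (m - 1) * (s - g A) - (\<Sum>B\<in>F - {A}. g B)"
          by (simp only: sum_subtractf sum_constant right_diff_distrib c[OF that])
        also have "(\<Sum>B\<in>F - {A}. g B) = s - g A"
          using that Suc.prems(1) by (simp add: sum_diff1 s_def)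
        finally show ?thesis .
      qed
      have "(\<Sum>A\<in>F. \<Sum>B\<in>F - {A}. s - g A - g B) = (\<Sum>A\<in>F. (m - 1) * (s - g A) - (s - g A))"
        by (intro sum.cong refl a)
      also have "\<dots> = (m - 2) * (\<Sum>A\<in>F. s - g A)"
        unfolding sum_distrib_left by (intro sum.cong refl) (simp add: algebra_simps)
      also have "(\<Sum>A\<in>F. s - g A) = m * s - s"
        by (simp add: sum_subtractf m_def s_def)
      finally have eq: "(\<Sum>A\<in>F. \<Sum>B\<in>F - {A}. s - g A - g B) = (m - 2) * (m * s - s)" .
      show ?thesis unfolding sum.distrib eq by (simp add: algebra_simps)
    qed
    also have "\<dots> \<le> m * (m - 1) * s - 2 * (m - 1) * s + 2 * m * s"
      using pair[OF Suc.prems(1,3,4)] by (simp add: m_def s_def)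
    also have "\<dots> = m * (m - 1) * ((1 + 2 / (m * (m - 1))) * s)"
      using m2' by (simp add: field_simps)
    finally obtain A B where AB: "A \<in> F" "B \<in> F" "A \<noteq> B"
      and le: "s - g A - g B + g (A \<union> B) \<le> (1 + 2 / (m * (m - 1))) * s"
      using exists_pair_le_average[OF Suc.prems(1) m2, of "\<lambda>A B. s - g A - g B + g (A \<union> B)"]
      unfolding m_def by blast
    define F' where "F' = insert (A \<union> B) (F - {A, B})"
    have disj: "A \<inter> C = {}" "B \<inter> C = {}" if "C \<in> F - {A, B}" for C
      using that AB Suc.prems(3) by (auto simp: pairwise_def disjnt_def)
    \<comment> \<open>Were the union already another block, it would be disjoint from its nonempty
      subset \<open>A\<close>. Hence the number of blocks drops by exactly one.\<close>
    have notin: "A \<union> B \<notin> F - {A, B}"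
      using disj(1)[of "A \<union> B"] AB(1) Suc.prems(4) by auto
    have fin: "finite F'" using Suc.prems(1) by (simp add: F'_def)
    have card: "card F' = m'"
    proof -
      have "card (F - {A, B}) = card F - 2"
        using AB Suc.prems(1) by (simp add: card_Diff_subset)
      then show ?thesis
        using notin Suc.prems(1) Suc.hyps(2) m2 by (simp add: F'_def)
    qed
    have un: "\<Union>F' = \<Union>F" using AB by (auto simp: F'_def)
    have pw: "pairwise disjnt F'"
    proof -
      have "disjnt (A \<union> B) C \<and> disjnt C (A \<union> B)" if "C \<in> F - {A, B}" for C
        using disj[OF that] by (simp add: disjnt_def Int_Un_distrib Int_commute)
      moreover have "pairwise disjnt (F - {A, B})"
        by (rule pairwise_subset[OF Suc.prems(3)]) auto
      ultimately show ?thesis unfolding F'_def pairwise_insert by simp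
    qed
    have ne: "{} \<notin> F'" using AB Suc.prems(4) by (auto simp: F'_def)
    have "g (\<Union>F) \<le> exp (2 - 2 / real (card F')) * sum g F'"
      using Suc.hyps(1)[OF card[symmetric] fin _ pw ne] unfolding un by (simp add: F'_def)
    also have "sum g F' = s - g A - g B + g (A \<union> B)"
    proof -
      have "sum g F' = g (A \<union> B) + sum g (F - {A, B})"
        using notin Suc.prems(1) by (simp add: F'_def)
      also have "sum g (F - {A, B}) = s - sum g {A, B}"
        unfolding s_def by (rule sum_diff) (use AB Suc.prems(1) in auto)
      finally show ?thesis using AB by simp
    qed
    also have "exp (2 - 2 / real (card F')) * (s - g A - g B + g (A \<union> B))
        \<le> exp (2 - 2 / real (card F')) * (exp (2 / (m * (m - 1))) * s)"
      using le s0 by (intro mult_left_mono order_trans[OF le] mult_right_mono exp_ge_add_one_self) auto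
    also have "\<dots> = exp (2 - 2 / (m - 1) + 2 / (m * (m - 1))) * s"
      using card Suc.hyps(2) by (simp add: m_def exp_add flip: Suc.hyps(2))
    also have "2 - 2 / (m - 1) + 2 / (m * (m - 1)) = 2 - 2 / m"
    proof -
      have "m \<noteq> 0" "m - 1 \<noteq> 0" using m2' by auto
      then have "2 / (m * (m - 1)) = 2 / (m - 1) - 2 / m" by (simp add: diff_frac_eq)
      then show ?thesis by simp
    qed
    finally show ?thesis by (simp add: m_def s_def)
  qed
qed

text \<open>
  The hypothesis \<open>cut_paste\<close> is the rectangle property of the distributions of the transcript
  on the inputs in which exactly the players of \<open>A\<close> hold a one.
\<close>
lemma hellinger_union_le:
  fixes Q :: "'a set \<Rightarrow> 'l \<Rightarrow> real"
  assumes K: "finite K" "K \<noteq> {}"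
    and nonneg: "\<And>A l. Q A l \<ge> 0"
    and total: "\<And>A. (\<Sum>l\<in>L. Q A l) = 1"
    and cut_paste: "\<And>A B l. A \<inter> B = {} \<Longrightarrow> Q {} l * Q (A \<union> B) l = Q A l * Q B l"
  shows "(\<Sum>l\<in>L. (sqrt (Q {} l) - sqrt (Q K l))\<^sup>2)
    \<le> exp 2 * (\<Sum>i\<in>K. \<Sum>l\<in>L. (sqrt (Q {} l) - sqrt (Q {i} l))\<^sup>2)"
proof -
  define g where "g A = (\<Sum>l\<in>L. (sqrt (Q {} l) - sqrt (Q A l))\<^sup>2)" for A
  \<comment> \<open>The distance depends only on the products \<open>Q A l * Q B l\<close>, which is
    what \<open>cut_paste\<close> controls.\<close>
  have expand: "(\<Sum>l\<in>L. (sqrt (Q A l) - sqrt (Q B l))\<^sup>2) = 2 - 2 * (\<Sum>l\<in>L. sqrt (Q A l * Q B l))"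
    for A B
    using nonneg
    by (simp add: power2_diff sum.distrib sum_subtractf total real_sqrt_mult sum_distrib_left
        mult.assoc)
  have g0: "g A \<ge> 0" for A unfolding g_def by (intro sum_nonneg) simp
  have gU: "g (A \<union> B) = (\<Sum>l\<in>L. (sqrt (Q A l) - sqrt (Q B l))\<^sup>2)" if "A \<inter> B = {}" for A B
    unfolding g_def expand by (simp add: cut_paste[OF that])
  have pair: "(\<Sum>A\<in>F. \<Sum>B\<in>F - {A}. g (A \<union> B)) \<le> 2 * card F * (\<Sum>A\<in>F. g A)"
    if F: "finite F" "pairwise disjnt F" "{} \<notin> F" for F
  proof -
    have "(\<Sum>A\<in>F. \<Sum>B\<in>F - {A}. g (A \<union> B))
        = (\<Sum>A\<in>F. \<Sum>B\<in>F - {A}. \<Sum>l\<in>L. (sqrt (Q A l) - sqrt (Q B l))\<^sup>2)"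
      by (intro sum.cong refl gU) (use F in \<open>auto simp: pairwise_def disjnt_def\<close>)
    also have "\<dots> \<le> (\<Sum>A\<in>F. \<Sum>B\<in>F. \<Sum>l\<in>L. (sqrt (Q A l) - sqrt (Q B l))\<^sup>2)"
      using F by (intro sum_mono sum_mono2) (auto intro!: sum_nonneg)
    also have "\<dots> = (\<Sum>A\<in>F. \<Sum>l\<in>L. \<Sum>B\<in>F. (sqrt (Q A l) - sqrt (Q B l))\<^sup>2)"
      by (intro sum.cong refl sum.swap)
    also have "\<dots> = (\<Sum>l\<in>L. \<Sum>A\<in>F. \<Sum>B\<in>F. (sqrt (Q A l) - sqrt (Q B l))\<^sup>2)"
      by (rule sum.swap)
    also have "\<dots> \<le> (\<Sum>l\<in>L. 2 * card F * (\<Sum>A\<in>F. (sqrt (Q {} l) - sqrt (Q A l))\<^sup>2))"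
      by (intro sum_mono sum_pairs_sq_le F)
    also have "\<dots> = 2 * card F * (\<Sum>A\<in>F. g A)"
      unfolding g_def sum_distrib_left[symmetric] by (subst sum.swap) simp
    finally show ?thesis .
  qed
  define F where "F = (\<lambda>i. {i}) ` K"
  have sumF: "(\<Sum>A\<in>F. g A) = (\<Sum>i\<in>K. g {i})"
    unfolding F_def by (subst sum.reindex) auto
  have "g (\<Union>F) \<le> exp (2 - 2 / card F) * (\<Sum>A\<in>F. g A)"
    by (rule merge_blocks[OF pair g0]) (use K in \<open>auto simp: F_def pairwise_def disjnt_def\<close>)
  also have "\<dots> \<le> exp 2 * (\<Sum>A\<in>F. g A)"
    by (intro mult_right_mono sum_nonneg g0) simp
  finally show ?thesis using sumF by (simp add: F_def g_def)
qed

section \<open>Information revealed about a block of coordinates\<close>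

text \<open>The sub-Gaussian bound \<open>cosh x \<le> exp (x\<^sup>2 / 2)\<close> for a random
  sign, obtained from Hoeffding's bound for a fair coin.\<close>

lemma exp_add_exp_minus_le: "exp (x - x\<^sup>2 / 2) + exp (- x - x\<^sup>2 / 2) \<le> (2::real)"
proof -
  have "cosh x \<le> exp (x\<^sup>2 / 2)"
  proof -
    define y where "y = \<bar>x\<bar>"
    have "- (2 * y) * (1/2) + ln (1 + (1/2) * (exp (2 * y) - 1)) \<le> (2 * y)\<^sup>2 / 8"
      by (rule Hoeffdings_lemma_aux) (auto simp: y_def)
    then have "ln ((1 + exp (2 * y)) / 2) \<le> y + y\<^sup>2 / 2"
      by (simp add: field_simps)
    then have "exp (ln ((1 + exp (2 * y)) / 2)) \<le> exp (y + y\<^sup>2 / 2)" by simp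
    then have "(1 + exp (2 * y)) / 2 \<le> exp (y + y\<^sup>2 / 2)"
      by (subst (asm) exp_ln) (auto intro: add_pos_pos)
    then have "(1 + exp (2 * y)) / 2 * exp (- y) \<le> exp (y + y\<^sup>2 / 2) * exp (- y)"
      by (rule mult_right_mono) simp
    then have "cosh y \<le> exp (y\<^sup>2 / 2)"
      by (simp add: cosh_def field_simps flip: exp_add)
    then show ?thesis by (simp add: y_def cosh_real_abs)
  qed
  then have "(exp x + exp (- x)) * exp (- (x\<^sup>2 / 2)) \<le> 2 * exp (x\<^sup>2 / 2) * exp (- (x\<^sup>2 / 2))"
    by (intro mult_right_mono) (auto simp: cosh_def)
  then show ?thesis by (simp add: distrib_right mult.assoc flip: exp_add)
qed

text \<open>Members get the negative sign, so that the mean of the sign given \<open>T B = l\<close>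
  is the bias \<open>a l j\<close> defined below.\<close>

definition spin :: "nat \<Rightarrow> nat set \<Rightarrow> real" where
  "spin j B = (if j \<in> B then -1 else 1)"

text \<open>The exponential factorises over coordinates, and each coordinate contributes at most 2
  by the sub-Gaussian bound.\<close>

lemma sum_exp_spin_le:
  fixes a :: "nat \<Rightarrow> real"
  assumes "finite S"
  shows "(\<Sum>X\<in>Pow S. exp (\<Sum>j\<in>S. a j * spin j X - (a j)\<^sup>2 / 2)) \<le> 2 ^ card S"
proof -
  have "(\<Sum>X\<in>Pow S. exp (\<Sum>j\<in>S. a j * spin j X - (a j)\<^sup>2 / 2))
      = (\<Sum>X\<in>Pow S. (\<Prod>j\<in>X. exp (- a j - (a j)\<^sup>2 / 2)) * (\<Prod>j\<in>S - X. exp (a j - (a j)\<^sup>2 / 2)))"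
  proof (intro sum.cong refl)
    fix X assume "X \<in> Pow S"
    then have "exp (\<Sum>j\<in>S. a j * spin j X - (a j)\<^sup>2 / 2)
      = (\<Prod>j\<in>S - X. exp (a j * spin j X - (a j)\<^sup>2 / 2)) * (\<Prod>j\<in>X. exp (a j * spin j X - (a j)\<^sup>2 / 2))"
      using assms by (simp add: exp_sum prod.subset_diff)
    then show "exp (\<Sum>j\<in>S. a j * spin j X - (a j)\<^sup>2 / 2)
      = (\<Prod>j\<in>X. exp (- a j - (a j)\<^sup>2 / 2)) * (\<Prod>j\<in>S - X. exp (a j - (a j)\<^sup>2 / 2))"
      by (simp add: spin_def mult.commute)
  qed
  also have "\<dots> = (\<Prod>j\<in>S. exp (- a j - (a j)\<^sup>2 / 2) + exp (a j - (a j)\<^sup>2 / 2))"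
    by (rule prod_add[symmetric]) (rule assms)
  also have "\<dots> \<le> (\<Prod>j\<in>S. 2)"
    using exp_add_exp_minus_le by (intro prod_mono) (auto simp: add.commute intro!: add_nonneg_nonneg)
  finally show ?thesis by simp
qed

text \<open>Follows from \<open>a + b \<le> (sqrt a + sqrt b)\<^sup>2\<close>; it turns Hellinger
  terms into squared biases.\<close>

lemma sqrt_diff_sq_le:
  assumes "a \<ge> 0" "b \<ge> 0"
  shows "(sqrt a - sqrt b)\<^sup>2 \<le> (a - b)\<^sup>2 / (a + b)"
proof (cases "a + b = 0")
  case True
  then show ?thesis using assms by (simp add: add_nonneg_eq_0_iff)
next
  case False
  then have pos: "a + b > 0" using assms by simp
  have "a + b \<le> (sqrt a + sqrt b)\<^sup>2" using assms by (simp add: power2_sum)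
  then have "(sqrt a - sqrt b)\<^sup>2 * (a + b) \<le> (sqrt a - sqrt b)\<^sup>2 * (sqrt a + sqrt b)\<^sup>2"
    by (intro mult_left_mono) auto
  also have "\<dots> = ((sqrt a)\<^sup>2 - (sqrt b)\<^sup>2)\<^sup>2"
    by (simp add: power2_eq_square algebra_simps)
  finally show ?thesis using pos assms by (simp add: field_simps)
qed

text \<open>Each subset of \<open>N - {j}\<close> arises from two subsets of \<open>N\<close>, so
  conditioning on coordinate \<open>j\<close> can be written as an average over all of
  \<open>Pow N\<close>.\<close>

lemma sum_Pow_remove:
  fixes f :: "nat set \<Rightarrow> real"
  assumes "finite N" "j \<in> N"
  shows "(\<Sum>B\<in>Pow N. f (B - {j})) = 2 * (\<Sum>B\<in>Pow (N - {j}). f B)"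
    and "(\<Sum>B\<in>Pow N. f (insert j B)) = 2 * (\<Sum>B\<in>Pow (N - {j}). f (insert j B))"
    and "(\<Sum>B\<in>Pow N. f B) = (\<Sum>B\<in>Pow (N - {j}). f B) + (\<Sum>B\<in>Pow (N - {j}). f (insert j B))"
proof -
  have split: "(\<Sum>B\<in>Pow N. h B) = (\<Sum>B\<in>Pow (N - {j}). h B) + (\<Sum>B\<in>Pow (N - {j}). h (insert j B))"
    for h :: "nat set \<Rightarrow> real"
  proof -
    have "(\<Sum>B\<in>Pow (insert j (N - {j})). h B)
        = (\<Sum>B\<in>Pow (N - {j}). h B) + (\<Sum>B\<in>insert j ` Pow (N - {j}). h B)"
      unfolding Pow_insert using assms by (intro sum.union_disjoint) auto
    also have "(\<Sum>B\<in>insert j ` Pow (N - {j}). h B) = (\<Sum>B\<in>Pow (N - {j}). h (insert j B))"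
      by (subst sum.reindex) (auto intro!: inj_onI)
    finally show ?thesis using assms(2) by (simp add: insert_absorb)
  qed
  show "(\<Sum>B\<in>Pow N. f B) = (\<Sum>B\<in>Pow (N - {j}). f B) + (\<Sum>B\<in>Pow (N - {j}). f (insert j B))"
    by (rule split)
  have "(\<Sum>B\<in>Pow (N - {j}). f (B - {j})) = (\<Sum>B\<in>Pow (N - {j}). f B)"
    "(\<Sum>B\<in>Pow (N - {j}). f (insert j B - {j})) = (\<Sum>B\<in>Pow (N - {j}). f B)"
    by (intro sum.cong refl arg_cong[of _ _ f]; auto)+
  then show "(\<Sum>B\<in>Pow N. f (B - {j})) = 2 * (\<Sum>B\<in>Pow (N - {j}). f B)"
    by (subst split) simp
  show "(\<Sum>B\<in>Pow N. f (insert j B)) = 2 * (\<Sum>B\<in>Pow (N - {j}). f (insert j B))"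
    by (subst split) simp
qed

text \<open>The law of \<open>T B\<close> for a uniformly random subset \<open>B\<close> of
  \<open>N\<close>.\<close>

definition freq :: "nat set \<Rightarrow> (nat set \<Rightarrow> 'l) \<Rightarrow> 'l \<Rightarrow> real" where
  "freq N T l = card {B\<in>Pow N. T B = l} / 2 ^ card N"

lemma freq_nonneg: "freq N T l \<ge> 0"
  by (simp add: freq_def)

lemma sum_freq_mult:
  assumes "finite N" "finite L" "T ` Pow N \<subseteq> L"
  shows "(\<Sum>l\<in>L. freq N T l * h l) = (\<Sum>B\<in>Pow N. h (T B)) / 2 ^ card N"
proof -
  have "(\<Sum>B\<in>Pow N. h (T B)) = (\<Sum>l\<in>L. \<Sum>B | B \<in> Pow N \<and> T B = l. h (T B))"
    by (rule sum.group[symmetric]) (use assms in auto)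
  also have "\<dots> = (\<Sum>l\<in>L. card {B\<in>Pow N. T B = l} * h l)"
    by (intro sum.cong refl) auto
  finally show ?thesis by (simp add: freq_def sum_divide_distrib)
qed

lemma freq_conv_sum: "finite N \<Longrightarrow> freq N T l = (\<Sum>B\<in>Pow N. if T B = l then 1 else 0) / 2 ^ card N"
  by (simp add: freq_def sum.If_cases Int_def conj_commute)

text \<open>
  If \<open>T\<close> takes at most \<open>M\<close> values once the coordinates outside \<open>S\<close> are fixed, it reveals
  little about the coordinates in \<open>S\<close>. Let \<open>a l j\<close> be the bias of coordinate \<open>j\<close> given
  \<open>T B = l\<close>. A union bound over the \<open>M\<close> values shows that the exponential moment of
  \<open>Z B = (\<Sum>j\<in>S. a (T B) j * spin j B - (a (T B) j)\<^sup>2 / 2)\<close> is at most \<open>M\<close>, so its mean,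
  which is half the expected squared bias, is at most \<open>ln M\<close>.
\<close>
lemma sum_hellinger_coordinates_le:
  fixes T :: "nat set \<Rightarrow> 'l"
  assumes N: "finite N" "S \<subseteq> N" and L: "finite L" "range T \<subseteq> L" and M: "M > 0"
    and few: "\<And>Y. Y \<subseteq> N - S \<Longrightarrow> card ((\<lambda>X. T (Y \<union> X)) ` Pow S) \<le> M"
  shows "(\<Sum>j\<in>S. \<Sum>l\<in>L. (sqrt (freq N (\<lambda>B. T (B - {j})) l) - sqrt (freq N (\<lambda>B. T (insert j B)) l))\<^sup>2)
    \<le> 4 * ln M"
proof -
  have finS: "finite S" using N finite_subset by blast
  define p0 where "p0 j l = freq N (\<lambda>B. T (B - {j})) l" for j l
  define p1 where "p1 j l = freq N (\<lambda>B. T (insert j B)) l" for j l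
  define p where "p l = freq N T l" for l
  \<comment> \<open>Where \<open>p l = 0\<close>, division by zero makes the bias 0 for
    \<open>j\<close> in \<open>N\<close>.\<close>
  define a where "a l j = (p0 j l - p1 j l) / (p0 j l + p1 j l)" for l j
  define Z where "Z B = (\<Sum>j\<in>S. a (T B) j * spin j B - (a (T B) j)\<^sup>2 / 2)" for B
  have nn: "p0 j l \<ge> 0" "p1 j l \<ge> 0" for j l by (simp_all add: p0_def p1_def freq_nonneg)
  have p01: "p0 j l + p1 j l = 2 * p l" if "j \<in> N" for j l
    unfolding p0_def p1_def p_def freq_conv_sum[OF N(1)]
      sum_Pow_remove(1)[OF N(1) that, of "\<lambda>B. if T B = l then 1 else 0"]
      sum_Pow_remove(2)[OF N(1) that, of "\<lambda>B. if T B = l then 1 else 0"]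
      sum_Pow_remove(3)[OF N(1) that, of "\<lambda>B. if T B = l then 1 else 0"]
    by (simp add: field_simps)
  have spin: "(\<Sum>B\<in>Pow N. if T B = l then spin j B else 0) / 2 ^ card N = (p0 j l - p1 j l) / 2"
    if "j \<in> N" for j l
  proof -
    have "(\<Sum>B\<in>Pow (N - {j}). if T B = l then spin j B else 0) = (\<Sum>B\<in>Pow (N - {j}). if T B = l then 1 else 0)"
      by (intro sum.cong refl) (auto simp: spin_def)
    moreover have "(\<Sum>B\<in>Pow (N - {j}). if T (insert j B) = l then spin j (insert j B) else 0)
        = - (\<Sum>B\<in>Pow (N - {j}). if T (insert j B) = l then 1 else 0)"
      unfolding sum_negf[symmetric] by (intro sum.cong refl) (auto simp: spin_def)
    ultimately show ?thesis
      unfolding p0_def p1_def freq_conv_sum[OF N(1)]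
        sum_Pow_remove(1)[OF N(1) that, of "\<lambda>B. if T B = l then 1 else 0"]
        sum_Pow_remove(2)[OF N(1) that, of "\<lambda>B. if T B = l then 1 else 0"]
        sum_Pow_remove(3)[OF N(1) that, of "\<lambda>B. if T B = l then spin j B else 0"]
      by (simp add: field_simps)
  qed
  have moment: "(\<Sum>B\<in>Pow N. exp (Z B)) \<le> real M * 2 ^ card N"
  proof -
    have "(\<Sum>B\<in>Pow N. exp (Z B)) = (\<Sum>(Y, X)\<in>Pow (N - S) \<times> Pow S. exp (Z (Y \<union> X)))"
      by (rule sum.reindex_bij_witness[of _ "\<lambda>(Y, X). Y \<union> X" "\<lambda>B. (B - S, B \<inter> S)"])
        (use N in \<open>auto intro!: arg_cong[of _ _ Z]\<close>)
    also have "\<dots> = (\<Sum>Y\<in>Pow (N - S). \<Sum>X\<in>Pow S. exp (Z (Y \<union> X)))"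
      by (rule sum.cartesian_product[symmetric])
    also have "\<dots> \<le> (\<Sum>Y\<in>Pow (N - S). real M * 2 ^ card S)"
    proof (rule sum_mono)
      fix Y assume Y: "Y \<in> Pow (N - S)"
      define R where "R = (\<lambda>X. T (Y \<union> X)) ` Pow S"
      define e where "e l X = exp (\<Sum>j\<in>S. a l j * spin j X - (a l j)\<^sup>2 / 2)" for l X
      \<comment> \<open>The bias vector depends on \<open>X\<close> through
        \<open>T (Y \<union> X)\<close>. Summing over all values in \<open>R\<close> decouples them
        and costs the factor \<open>M\<close>.\<close>
      have "(\<Sum>X\<in>Pow S. exp (Z (Y \<union> X))) \<le> (\<Sum>X\<in>Pow S. \<Sum>l\<in>R. e l X)"
      proof (rule sum_mono)
        fix X assume X: "X \<in> Pow S"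
        have "spin j (Y \<union> X) = spin j X" if "j \<in> S" for j
          using that Y by (auto simp: spin_def)
        then have "exp (Z (Y \<union> X)) = e (T (Y \<union> X)) X"
          by (simp add: Z_def e_def)
        also have "\<dots> \<le> (\<Sum>l\<in>R. e l X)"
          by (rule member_le_sum) (use X finS in \<open>auto simp: R_def e_def\<close>)
        finally show "exp (Z (Y \<union> X)) \<le> (\<Sum>l\<in>R. e l X)" .
      qed
      also have "\<dots> = (\<Sum>l\<in>R. \<Sum>X\<in>Pow S. e l X)" by (rule sum.swap)
      also have "\<dots> \<le> (\<Sum>l\<in>R. 2 ^ card S)"
        unfolding e_def by (intro sum_mono sum_exp_spin_le finS)
      also have "\<dots> \<le> real M * 2 ^ card S"
        using few[of Y] Y by (simp add: R_def)
      finally show "(\<Sum>X\<in>Pow S. exp (Z (Y \<union> X))) \<le> real M * 2 ^ card S" .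
    qed
    also have "\<dots> = real M * (2 ^ card (N - S) * 2 ^ card S)"
      using N by (simp add: card_Pow)
    also have "2 ^ card (N - S) * 2 ^ card S = (2::real) ^ card N"
      using N finS by (simp add: card_Diff_subset card_mono flip: power_add)
    finally show ?thesis .
  qed
  have mean_le: "(\<Sum>B\<in>Pow N. Z B) / 2 ^ card N \<le> ln M"
  proof -
    \<comment> \<open>Jensen's inequality in elementary form: \<open>1 + x \<le> exp x\<close> at
      \<open>x = Z B - ln M\<close>.\<close>
    have "(\<Sum>B\<in>Pow N. 1 + (Z B - ln M)) \<le> (\<Sum>B\<in>Pow N. exp (Z B - ln M))"
      by (intro sum_mono exp_ge_add_one_self)
    also have "\<dots> = (\<Sum>B\<in>Pow N. exp (Z B)) / M"
      using M by (simp add: exp_diff sum_divide_distrib)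
    also have "\<dots> \<le> 2 ^ card N" using moment M by (simp add: field_simps)
    finally show ?thesis
      using N(1) by (simp add: sum.distrib sum_subtractf card_Pow field_simps)
  qed
  \<comment> \<open>The linear term averages to \<open>p l * (a l j)\<^sup>2\<close>; the quadratic
    correction takes away half of it.\<close>
  have mean: "(\<Sum>B\<in>Pow N. Z B) / 2 ^ card N = (\<Sum>j\<in>S. \<Sum>l\<in>L. p l * (a l j)\<^sup>2 / 2)"
  proof -
    have "(\<Sum>B\<in>Pow N. Z B) / 2 ^ card N
        = (\<Sum>j\<in>S. (\<Sum>B\<in>Pow N. a (T B) j * spin j B) / 2 ^ card N
            - (\<Sum>B\<in>Pow N. (a (T B) j)\<^sup>2 / 2) / 2 ^ card N)"
      unfolding Z_def by (subst sum.swap) (simp add: sum_subtractf sum_divide_distrib diff_divide_distrib)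
    also have "\<dots> = (\<Sum>j\<in>S. (\<Sum>l\<in>L. p l * (a l j)\<^sup>2) - (\<Sum>l\<in>L. p l * ((a l j)\<^sup>2 / 2)))"
    proof (intro sum.cong refl arg_cong2[of _ _ _ _ minus])
      fix j assume "j \<in> S"
      then have j: "j \<in> N" using N by auto
      have "(\<Sum>B\<in>Pow N. a (T B) j * spin j B) = (\<Sum>B\<in>Pow N. \<Sum>l\<in>L. a l j * (if T B = l then spin j B else 0))"
        using L by (intro sum.cong refl) (auto simp: if_distrib[of "(*) _"] cong: if_cong)
      also have "\<dots> = (\<Sum>l\<in>L. a l j * (\<Sum>B\<in>Pow N. if T B = l then spin j B else 0))"
        by (subst sum.swap) (simp add: sum_distrib_left)
      finally have "(\<Sum>B\<in>Pow N. a (T B) j * spin j B) / 2 ^ card N = (\<Sum>l\<in>L. a l j * ((p0 j l - p1 j l) / 2))"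
        unfolding spin[OF j, symmetric] by (simp only: sum_divide_distrib[of _ L] times_divide_eq_right)
      also have "\<dots> = (\<Sum>l\<in>L. p l * (a l j)\<^sup>2)"
      proof (intro sum.cong refl)
        fix l
        have "p0 j l - p1 j l = (p0 j l + p1 j l) * a l j"
          using nn[of j l] by (cases "p0 j l + p1 j l = 0") (auto simp: a_def add_nonneg_eq_0_iff)
        then have "p0 j l - p1 j l = 2 * p l * a l j"
          unfolding p01[OF j] .
        then show "a l j * ((p0 j l - p1 j l) / 2) = p l * (a l j)\<^sup>2"
          by (simp add: power2_eq_square)
      qed
      finally show "(\<Sum>B\<in>Pow N. a (T B) j * spin j B) / 2 ^ card N = (\<Sum>l\<in>L. p l * (a l j)\<^sup>2)" .
      show "(\<Sum>B\<in>Pow N. (a (T B) j)\<^sup>2 / 2) / 2 ^ card N = (\<Sum>l\<in>L. p l * ((a l j)\<^sup>2 / 2))"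
        unfolding p_def using L by (intro sum_freq_mult[OF N(1) L(1), symmetric]) auto
    qed
    also have "\<dots> = (\<Sum>j\<in>S. \<Sum>l\<in>L. p l * (a l j)\<^sup>2 / 2)"
      by (simp add: sum_subtractf[symmetric])
    finally show ?thesis .
  qed
  have "(\<Sum>j\<in>S. \<Sum>l\<in>L. (sqrt (p0 j l) - sqrt (p1 j l))\<^sup>2) \<le> (\<Sum>j\<in>S. \<Sum>l\<in>L. 4 * (p l * (a l j)\<^sup>2 / 2))"
  proof (intro sum_mono)
    fix j l assume "j \<in> S"
    then have j: "j \<in> N" using N by auto
    have "(sqrt (p0 j l) - sqrt (p1 j l))\<^sup>2 \<le> (p0 j l - p1 j l)\<^sup>2 / (p0 j l + p1 j l)"
      by (intro sqrt_diff_sq_le nn)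
    also have "\<dots> = (p0 j l + p1 j l) * (a l j)\<^sup>2"
      by (simp add: a_def power2_eq_square)
    finally show "(sqrt (p0 j l) - sqrt (p1 j l))\<^sup>2 \<le> 4 * (p l * (a l j)\<^sup>2 / 2)"
      unfolding p01[OF j] by simp
  qed
  also have "\<dots> = 4 * ((\<Sum>B\<in>Pow N. Z B) / 2 ^ card N)"
    by (simp add: mean sum_distrib_left)
  also have "\<dots> \<le> 4 * ln M" using mean_le by simp
  finally show ?thesis by (simp add: p0_def p1_def)
qed

section \<open>Planted inputs\<close>

text \<open>\<open>B\<close> holds the columns whose owner has bit 1; a uniform \<open>B\<close>
  gives the law \<open>D0\<close> for fixed owners \<open>w\<close>.\<close>

definition sparse_input :: "(nat \<Rightarrow> nat) \<Rightarrow> nat set \<Rightarrow> input" where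
  "sparse_input w B = (\<lambda>i j. w j = i \<and> j \<in> B)"

text \<open>\<open>B\<close> may contain \<open>j\<close>, but column \<open>j\<close> is
  overwritten; thus all choices of \<open>A\<close> share one sample space.\<close>

definition planted :: "(nat \<Rightarrow> nat) \<Rightarrow> nat \<Rightarrow> nat set \<Rightarrow> nat set \<Rightarrow> input" where
  "planted w j A B = (\<lambda>i j'. if j' = j then i \<in> A else sparse_input w B i j')"

lemma planted_cong:
  "(\<And>j'. j' \<noteq> j \<Longrightarrow> w j' = w' j') \<Longrightarrow> planted w j A B = planted w' j A B"
  by (auto simp: planted_def sparse_input_def fun_eq_iff)

lemma planted_empty: "planted w j {} B = sparse_input w (B - {j})"
  by (auto simp: planted_def sparse_input_def fun_eq_iff)

text \<open>Planting a one for the owner just fixes its random bit, so the input is still sparse and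
  the information bound applies.\<close>

lemma planted_singleton: "planted w j {w j} B = sparse_input w (insert j B)"
  by (auto simp: planted_def sparse_input_def fun_eq_iff)

lemma well_shaped_sparse_input:
  assumes "B \<subseteq> {..<n}" "\<And>j. j < n \<Longrightarrow> w j < k"
  shows "well_shaped k n (sparse_input w B)"
  using assms by (fastforce simp: well_shaped_def sparse_input_def)

lemma well_shaped_planted:
  assumes "B \<subseteq> {..<n}" "\<And>j. j < n \<Longrightarrow> w j < k" "j < n" "A \<subseteq> {..<k}"
  shows "well_shaped k n (planted w j A B)"
  using assms by (fastforce simp: well_shaped_def sparse_input_def planted_def)

definition leaf_freq ::
    "nat \<Rightarrow> protocol \<Rightarrow> (nat \<Rightarrow> nat) \<Rightarrow> nat \<Rightarrow> nat set \<Rightarrow> bool list \<Rightarrow> real" where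
  "leaf_freq n P w j A = freq {..<n} (\<lambda>B. transcript P (planted w j A B))"

text \<open>Squared Hellinger distance without the factor 1/2, so it is at most 2.\<close>

definition hellinger :: "nat \<Rightarrow> protocol \<Rightarrow> (nat \<Rightarrow> nat) \<Rightarrow> nat \<Rightarrow> nat set \<Rightarrow> real" where
  "hellinger n P w j A =
    (\<Sum>l\<in>range (transcript P). (sqrt (leaf_freq n P w j {} l) - sqrt (leaf_freq n P w j A l))\<^sup>2)"

text \<open>Planting overwrites column \<open>j\<close>, which makes the distance independent of
  \<open>w j\<close> when the owners are random.\<close>

lemma hellinger_cong:
  assumes "\<And>j'. j' \<noteq> j \<Longrightarrow> w j' = w' j'"
  shows "hellinger n P w j A = hellinger n P w' j A"
proof -
  have "planted w j C B = planted w' j C B" for C B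
    by (rule planted_cong) (rule assms)
  then show ?thesis by (simp add: hellinger_def leaf_freq_def)
qed

lemma sum_leaf_freq_mult:
  "(\<Sum>l\<in>range (transcript P). leaf_freq n P w j A l * h l)
    = (\<Sum>B\<in>Pow {..<n}. h (transcript P (planted w j A B))) / 2 ^ n"
  unfolding leaf_freq_def by (subst sum_freq_mult) (auto simp: finite_range_transcript)

lemma sum_leaf_freq: "(\<Sum>l\<in>range (transcript P). leaf_freq n P w j A l) = 1"
  using sum_leaf_freq_mult[of n P w j A "\<lambda>_. 1"] by (simp add: card_Pow)

lemma leaf_freq_nonneg: "leaf_freq n P w j A l \<ge> 0"
  by (simp add: leaf_freq_def freq_nonneg)

text \<open>The rectangle property by counting: two sets \<open>U\<close>, \<open>V\<close> exchange
  their columns owned by players of \<open>A\<close>, a self-inverse map on pairs.\<close>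

lemma leaf_freq_cut_paste:
  assumes "A \<inter> A' = {}"
  shows "leaf_freq n P w j {} l * leaf_freq n P w j (A \<union> A') l
    = leaf_freq n P w j A l * leaf_freq n P w j A' l"
proof -
  define S where "S = {j'. w j' \<in> A}"
  define E where "E C = {B\<in>Pow {..<n}. transcript P (planted w j C B) = l}" for C
  define swap where "swap = (\<lambda>(U, V). ((U - S) \<union> (V \<inter> S), (V - S) \<union> (U \<inter> S)))"
  \<comment> \<open>In the mixed input the players of \<open>A\<close> see \<open>V\<close> and the
    others see \<open>U\<close>.\<close>
  have mix: "transcript P (planted w j C ((U - S) \<union> (V \<inter> S))) = l"
    if "transcript P (planted w j C1 V) = l" "transcript P (planted w j C2 U) = l"
      "\<And>i. i \<in> C \<longleftrightarrow> (if i \<in> A then i \<in> C1 else i \<in> C2)" for C C1 C2 U V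
  proof -
    have "planted w j C ((U - S) \<union> (V \<inter> S))
        = (\<lambda>i. if i \<in> A then planted w j C1 V i else planted w j C2 U i)"
      using that(3) by (auto simp: planted_def sparse_input_def S_def fun_eq_iff)
    then show ?thesis using transcript_cut_paste[OF that(1,2), of A] by (simp only:)
  qed
  have "bij_betw swap (E {} \<times> E (A \<union> A')) (E A \<times> E A')"
  proof (rule bij_betw_byWitness[where f' = swap])
    show "\<forall>x\<in>E {} \<times> E (A \<union> A'). swap (swap x) = x" "\<forall>x\<in>E A \<times> E A'. swap (swap x) = x"
      unfolding swap_def by auto
    show "swap ` (E {} \<times> E (A \<union> A')) \<subseteq> E A \<times> E A'"
    proof -
      have "swap (U, V) \<in> E A \<times> E A'" if UV: "U \<in> E {}" "V \<in> E (A \<union> A')" for U V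
      proof -
        have "transcript P (planted w j A ((U - S) \<union> (V \<inter> S))) = l"
          by (rule mix[of "A \<union> A'" _ "{}"]) (use UV in \<open>auto simp: E_def\<close>)
        moreover have "transcript P (planted w j A' ((V - S) \<union> (U \<inter> S))) = l"
          by (rule mix[of "{}" _ "A \<union> A'"]) (use UV assms in \<open>auto simp: E_def\<close>)
        ultimately show ?thesis
          using UV by (auto simp: swap_def E_def)
      qed
      then show ?thesis by (metis (no_types, lifting) SigmaE image_subsetI)
    qed
    show "swap ` (E A \<times> E A') \<subseteq> E {} \<times> E (A \<union> A')"
    proof -
      have "swap (U, V) \<in> E {} \<times> E (A \<union> A')" if UV: "U \<in> E A" "V \<in> E A'" for U V
      proof -
        have "transcript P (planted w j {} ((U - S) \<union> (V \<inter> S))) = l"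
          by (rule mix[of A' _ A]) (use UV assms in \<open>auto simp: E_def\<close>)
        moreover have "transcript P (planted w j (A \<union> A') ((V - S) \<union> (U \<inter> S))) = l"
          by (rule mix[of A _ A']) (use UV in \<open>auto simp: E_def\<close>)
        ultimately show ?thesis
          using UV by (auto simp: swap_def E_def)
      qed
      then show ?thesis by (metis (no_types, lifting) SigmaE image_subsetI)
    qed
  qed
  then have "card (E {}) * card (E (A \<union> A')) = card (E A) * card (E A')"
    by (simp add: bij_betw_same_card flip: card_cartesian_product)
  then have "real (card (E {})) * real (card (E (A \<union> A'))) = real (card (E A)) * real (card (E A'))"
    by (simp flip: of_nat_mult)
  then show ?thesis by (simp add: leaf_freq_def freq_def E_def)
qed

text \<open>The information bound for the columns owned by player \<open>i\<close>: fixing the other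
  columns fixes all other players' inputs, which leaves at most \<open>2 ^ c i\<close>
  transcripts.\<close>

lemma sum_hellinger_singleton_le:
  assumes bd: "protocol_bounded k n c P" and w: "\<And>j. j < n \<Longrightarrow> w j < k" and i: "i < k"
  shows "(\<Sum>j | j < n \<and> w j = i. hellinger n P w j {i}) \<le> 4 * c i"
proof -
  define S where "S = {j. j < n \<and> w j = i}"
  define T where "T B = transcript P (sparse_input w B)" for B
  have "(\<Sum>j\<in>S. \<Sum>l\<in>range (transcript P). (sqrt (freq {..<n} (\<lambda>B. T (B - {j})) l)
      - sqrt (freq {..<n} (\<lambda>B. T (insert j B)) l))\<^sup>2) \<le> 4 * ln (real (2 ^ c i))"
  proof (rule sum_hellinger_coordinates_le)
    fix Y assume Y: "Y \<subseteq> {..<n} - S"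
    have "T (Y \<union> X) = transcript P ((sparse_input w Y)(i := sparse_input w X i))" if "X \<in> Pow S" for X
      unfolding T_def using that Y
      by (intro arg_cong[of _ _ "transcript P"]) (auto simp: sparse_input_def S_def fun_eq_iff)
    then have "(\<lambda>X. T (Y \<union> X)) ` Pow S
        = (\<lambda>x. transcript P ((sparse_input w Y)(i := x))) ` ((\<lambda>X. sparse_input w X i) ` Pow S)"
      unfolding image_image by (intro image_cong refl)
    moreover have "card ((\<lambda>x. transcript P ((sparse_input w Y)(i := x))) ` ((\<lambda>X. sparse_input w X i) ` Pow S))
        \<le> 2 ^ c i"
    proof (rule card_transcripts_le)
      fix x assume "x \<in> (\<lambda>X. sparse_input w X i) ` Pow S"
      then obtain X where X: "X \<subseteq> S" "x = sparse_input w X i" by auto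
      have "(sparse_input w Y)(i := x) = sparse_input w (Y \<union> X)"
        using X Y by (auto simp: sparse_input_def S_def fun_eq_iff)
      moreover have "well_shaped k n (sparse_input w (Y \<union> X))"
        by (rule well_shaped_sparse_input) (use X Y w in \<open>auto simp: S_def\<close>)
      ultimately show "bits_written i P ((sparse_input w Y)(i := x)) \<le> c i"
        using bd i by (simp add: protocol_bounded_def)
    qed
    ultimately show "card ((\<lambda>X. T (Y \<union> X)) ` Pow S) \<le> 2 ^ c i" by simp
  qed (auto simp: S_def T_def finite_range_transcript)
  also have "4 * ln (real (2 ^ c i)) = 4 * (c i * ln 2)" by (simp add: ln_realpow)
  also have "\<dots> \<le> 4 * c i"
    using ln_2_less_1 by (simp add: mult_left_le)
  also have "(\<Sum>j\<in>S. \<Sum>l\<in>range (transcript P). (sqrt (freq {..<n} (\<lambda>B. T (B - {j})) l)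
      - sqrt (freq {..<n} (\<lambda>B. T (insert j B)) l))\<^sup>2) = (\<Sum>j\<in>S. hellinger n P w j {i})"
    by (intro sum.cong refl)
      (auto simp: S_def T_def hellinger_def leaf_freq_def planted_empty planted_singleton)
  finally show ?thesis by (simp add: S_def)
qed

text \<open>Serves the case \<open>pmf \<nu> i = 0\<close>, where averaging over owners gives no
  bound. A player who writes nothing cannot affect the transcript.\<close>

lemma hellinger_silent_player:
  assumes bd: "protocol_bounded k n c P" and w: "\<And>j. j < n \<Longrightarrow> w j < k" and i: "i < k"
    and "c i = 0" "j < n"
  shows "hellinger n P w j {i} = 0"
proof -
  have "transcript P (planted w j {i} B) = transcript P (planted w j {} B)"
    if B: "B \<in> Pow {..<n}" for B
  proof -
    define X where "X = planted w j {} B"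
    define X' where "X' = planted w j {i} B"
    have X': "X' = X(i := X' i)" by (auto simp: X'_def X_def planted_def fun_eq_iff)
    have "card ((\<lambda>x. transcript P (X(i := x))) ` {X i, X' i}) \<le> 2 ^ c i"
    proof (rule card_transcripts_le)
      have "well_shaped k n X" "well_shaped k n X'"
        unfolding X_def X'_def using B w i \<open>j < n\<close> by (auto intro!: well_shaped_planted)
      then have "bits_written i P X \<le> c i" "bits_written i P X' \<le> c i"
        using bd i by (auto simp: protocol_bounded_def)
      then show "bits_written i P (X(i := x)) \<le> c i" if "x \<in> {X i, X' i}" for x
        using that X' by (metis fun_upd_triv insertE singletonD)
    qed
    then have "card {transcript P X, transcript P X'} \<le> 1"
      using X' \<open>c i = 0\<close> by simp
    then show ?thesis by (auto simp: X_def X'_def card_insert_if split: if_splits)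
  qed
  then have "leaf_freq n P w j {i} l = leaf_freq n P w j {} l" for l
    unfolding leaf_freq_def freq_def by (metis (mono_tags, lifting))
  then show ?thesis by (simp add: hellinger_def)
qed

text \<open>AM-GM for \<open>4 * x\<close> and \<open>y / 4\<close>; the large weight is meant for
  the law under which a leaf is an error.\<close>

lemma sqrt_mult_le:
  assumes "x \<ge> 0" "y \<ge> (0::real)"
  shows "sqrt (x * y) \<le> 2 * x + y / 8"
  using arith_geo_mean_sqrt[of "4 * x" "y / 4"] assms by (simp add: field_simps)

text \<open>Each leaf fixes the output and so counts as an error for one of the two laws. That law
  gets weight 2 and the other 1/8, so the affinity is at most twice the total error plus
  1/4.\<close>

lemma hellinger_ge:
  "hellinger n P w j A \<ge> 3 / 2
    - 4 * ((\<Sum>B\<in>Pow {..<n}. of_bool (run_output P (planted w j {} B))) / 2 ^ n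
      + (\<Sum>B\<in>Pow {..<n}. of_bool (\<not> run_output P (planted w j A B))) / 2 ^ n)"
proof -
  define L where "L = range (transcript P)"
  define p where "p = leaf_freq n P w j {}"
  define q where "q = leaf_freq n P w j A"
  have nn: "p l \<ge> 0" "q l \<ge> 0" for l by (simp_all add: p_def q_def leaf_freq_def freq_nonneg)
  have sums: "sum p L = 1" "sum q L = 1" by (simp_all add: p_def q_def L_def sum_leaf_freq)
  define a where "a = (\<Sum>B\<in>Pow {..<n}. of_bool (run_output P (planted w j {} B))) / (2 ^ n :: real)"
  define b where "b = (\<Sum>B\<in>Pow {..<n}. of_bool (\<not> run_output P (planted w j A B))) / (2 ^ n :: real)"
  have a: "(\<Sum>l\<in>L. p l * of_bool (last l)) = a"
    unfolding p_def L_def sum_leaf_freq_mult a_def last_transcript ..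
  have b: "(\<Sum>l\<in>L. q l * of_bool (\<not> last l)) = b"
    unfolding q_def L_def sum_leaf_freq_mult b_def last_transcript ..
  have "sqrt (p l * q l) \<le> 2 * (p l * of_bool (last l)) + 2 * (q l * of_bool (\<not> last l)) + (p l + q l) / 8"
    for l
    using sqrt_mult_le[OF nn(1)[of l] nn(2)[of l]] sqrt_mult_le[OF nn(2)[of l] nn(1)[of l]] nn[of l]
    by (auto simp: mult.commute add_divide_distrib)
  then have "(\<Sum>l\<in>L. sqrt (p l * q l))
      \<le> (\<Sum>l\<in>L. 2 * (p l * of_bool (last l)) + 2 * (q l * of_bool (\<not> last l)) + (p l + q l) / 8)"
    by (intro sum_mono)
  also have "\<dots> = 2 * a + 2 * b + 1 / 4"
    unfolding sum.distrib sum_distrib_left[symmetric] sum_divide_distrib[symmetric] a b sums by simp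
  finally have "(\<Sum>l\<in>L. sqrt (p l * q l)) \<le> 2 * a + 2 * b + 1 / 4" .
  moreover have "hellinger n P w j A = 2 - 2 * (\<Sum>l\<in>L. sqrt (p l * q l))"
    using nn sums
    by (simp add: hellinger_def L_def[symmetric] p_def[symmetric] q_def[symmetric] power2_diff
        sum.distrib sum_subtractf real_sqrt_mult sum_distrib_left mult.assoc)
  ultimately show ?thesis unfolding a_def[symmetric] b_def[symmetric] by simp
qed

lemma hellinger_all_le:
  assumes "k > 0"
  shows "hellinger n P w j {..<k} \<le> exp 2 * (\<Sum>i<k. hellinger n P w j {i})"
  unfolding hellinger_def
  by (rule hellinger_union_le)
    (use assms in \<open>auto simp: sum_leaf_freq leaf_freq_cut_paste leaf_freq_nonneg\<close>)

section \<open>The input distributions\<close>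

lemma expectation_bind_pmf_finite:
  fixes h :: "'b \<Rightarrow> real"
  assumes "finite (set_pmf p)" "\<And>x. x \<in> set_pmf p \<Longrightarrow> finite (set_pmf (f x))"
  shows "measure_pmf.expectation (bind_pmf p f) h
    = measure_pmf.expectation p (\<lambda>x. measure_pmf.expectation (f x) h)"
  using assms
  by (simp add: pmf_expectation_bind[of "set_pmf p"] integral_measure_pmf[of "set_pmf p"])

definition owners :: "nat \<Rightarrow> nat pmf \<Rightarrow> (nat \<Rightarrow> nat) pmf" where
  "owners n \<nu> = Pi_pmf {..<n} 0 (\<lambda>_. \<nu>)"

lemma finite_set_owners: "finite (set_pmf \<nu>) \<Longrightarrow> finite (set_pmf (owners n \<nu>))"
  unfolding owners_def by (simp add: set_Pi_pmf finite_PiE_dflt)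

lemma owners_range: "w \<in> set_pmf (owners n \<nu>) \<Longrightarrow> j < n \<Longrightarrow> w j \<in> set_pmf \<nu>"
  by (auto simp: owners_def set_Pi_pmf PiE_dflt_def)

text \<open>\<open>F\<close> is a function of the other coordinates, which are independent of
  \<open>w j\<close>.\<close>

lemma expectation_owners_mult:
  fixes F :: "(nat \<Rightarrow> nat) \<Rightarrow> real"
  assumes fin: "finite (set_pmf \<nu>)" and j: "j < n"
    and F: "\<And>w w'. (\<And>j'. j' \<noteq> j \<Longrightarrow> w j' = w' j') \<Longrightarrow> F w = F w'"
  shows "measure_pmf.expectation (owners n \<nu>) (\<lambda>w. of_bool (w j = i) * F w)
    = pmf \<nu> i * measure_pmf.expectation (owners n \<nu>) F"
proof -
  define R where "R = Pi_pmf ({..<n} - {j}) 0 (\<lambda>_. \<nu>)"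
  have finR: "finite (set_pmf R)"
    unfolding R_def using fin by (simp add: set_Pi_pmf finite_PiE_dflt)
  have own: "owners n \<nu> = do {y \<leftarrow> \<nu>; f \<leftarrow> R; return_pmf (f(j := y))}"
  proof -
    have "{..<n} = insert j ({..<n} - {j})" using j by auto
    then show ?thesis unfolding owners_def R_def by (metis Pi_pmf_insert' Diff_iff finite_Diff finite_lessThan singletonI)
  qed
  have upd: "F (f(j := y)) = F f" for f y by (rule F) simp
  have E: "measure_pmf.expectation (owners n \<nu>) G
      = measure_pmf.expectation \<nu> (\<lambda>y. measure_pmf.expectation R (\<lambda>f. G (f(j := y))))"
    for G :: "(nat \<Rightarrow> nat) \<Rightarrow> real"
    unfolding own using fin finR by (simp add: expectation_bind_pmf_finite)
  have "measure_pmf.expectation \<nu> (\<lambda>y. of_bool (y = i)) = pmf \<nu> i"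
    by (subst integral_measure_pmf_real[of "{i}"]) auto
  then show ?thesis unfolding E by (simp add: upd)
qed

text \<open>Owners and bits are independent, so all owners can be drawn first; the fair bits then
  form a uniform subset.\<close>

lemma D0_conv_owners:
  "D0 n \<nu> = bind_pmf (owners n \<nu>) (\<lambda>w. map_pmf (sparse_input w) (pmf_of_set (Pow {..<n})))"
proof -
  define u where "u = pmf_of_set (UNIV :: bool set)"
  have pair: "pair_pmf \<nu> u = bind_pmf \<nu> (\<lambda>x. bind_pmf u (\<lambda>b. return_pmf (x, b)))"
    by (simp add: pair_pmf_def)
  have "Pi_pmf {..<n} (0, False) (\<lambda>_. pair_pmf \<nu> u)
      = bind_pmf (owners n \<nu>) (\<lambda>w. bind_pmf (Pi_pmf {..<n} False (\<lambda>_. u))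
          (\<lambda>b. return_pmf (\<lambda>j. if j \<in> {..<n} then (w j, b j) else (0, False))))"
    unfolding pair owners_def
    by (subst Pi_pmf_bind[where d' = 0], simp, subst Pi_pmf_bind[where d' = False], simp, subst Pi_pmf_return_pmf) simp_all
  then have "D0 n \<nu> = bind_pmf (owners n \<nu>) (\<lambda>w. map_pmf (\<lambda>b. sparse_input w {j\<in>{..<n}. b j})
      (Pi_pmf {..<n} False (\<lambda>_. u)))"
    unfolding D0_def u_def[symmetric] atLeast0LessThan
    by (simp add: map_bind_pmf map_pmf_def[of _ "Pi_pmf _ _ _"] bind_assoc_pmf bind_return_pmf)
       (auto intro!: bind_pmf_cong arg_cong[of _ _ return_pmf] simp: sparse_input_def fun_eq_iff)
  also have "\<dots> = bind_pmf (owners n \<nu>) (\<lambda>w. map_pmf (sparse_input w) (map_pmf (\<lambda>b. {j\<in>{..<n}. b j})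
      (Pi_pmf {..<n} False (\<lambda>_. bernoulli_pmf (1 / 2)))))"
    by (simp add: pmf.map_comp o_def u_def bernoulli_pmf_half_conv_pmf_of_set)
  finally show ?thesis by (simp only: pmf_of_set_Pow_conv_bernoulli[OF finite_lessThan])
qed

lemma expectation_D0:
  fixes h :: "input \<Rightarrow> real"
  assumes "finite (set_pmf \<nu>)"
  shows "measure_pmf.expectation (D0 n \<nu>) h
    = measure_pmf.expectation (owners n \<nu>) (\<lambda>w. (\<Sum>B\<in>Pow {..<n}. h (sparse_input w B)) / 2 ^ n)"
  unfolding D0_conv_owners using assms
  by (simp add: expectation_bind_pmf_finite finite_set_owners integral_pmf_of_set Pow_not_empty card_Pow)

lemma finite_set_D0: "finite (set_pmf \<nu>) \<Longrightarrow> finite (set_pmf (D0 n \<nu>))"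
  by (simp add: D0_conv_owners finite_set_owners Pow_not_empty)

lemma expectation_D1:
  fixes h :: "input \<Rightarrow> real"
  assumes "finite (set_pmf \<nu>)" "n \<ge> 1"
  shows "measure_pmf.expectation (D1 k n \<nu>) h = measure_pmf.expectation (owners n \<nu>)
    (\<lambda>w. (\<Sum>j<n. (\<Sum>B\<in>Pow {..<n}. h (planted w j {..<k} B)) / 2 ^ n) / n)"
proof -
  have ne: "{0..<n} \<noteq> {}" using assms(2) by simp
  have "measure_pmf.expectation (D1 k n \<nu>) h = measure_pmf.expectation (D0 n \<nu>)
      (\<lambda>X. (\<Sum>j<n. h (\<lambda>i j'. if j' = j then i < k else X i j')) / n)"
    unfolding D1_def using assms(1) ne
    by (simp add: expectation_bind_pmf_finite finite_set_D0 integral_pmf_of_set atLeast0LessThan)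
  also have "\<dots> = measure_pmf.expectation (owners n \<nu>)
      (\<lambda>w. (\<Sum>B\<in>Pow {..<n}. (\<Sum>j<n. h (planted w j {..<k} B)) / n) / 2 ^ n)"
    unfolding expectation_D0[OF assms(1)] planted_def lessThan_iff ..
  also have "(\<lambda>w. (\<Sum>B\<in>Pow {..<n}. (\<Sum>j<n. h (planted w j {..<k} B)) / n) / 2 ^ n)
      = (\<lambda>w. (\<Sum>j<n. (\<Sum>B\<in>Pow {..<n}. h (planted w j {..<k} B)) / 2 ^ n) / n)"
  proof
    fix w
    have "(\<Sum>B\<in>Pow {..<n}. \<Sum>j<n. h (planted w j {..<k} B)) = (\<Sum>j<n. \<Sum>B\<in>Pow {..<n}. h (planted w j {..<k} B))"
      by (rule sum.swap)
    then show "(\<Sum>B\<in>Pow {..<n}. (\<Sum>j<n. h (planted w j {..<k} B)) / n) / 2 ^ n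
      = (\<Sum>j<n. (\<Sum>B\<in>Pow {..<n}. h (planted w j {..<k} B)) / 2 ^ n) / n"
      by (simp add: mult.commute flip: sum_divide_distrib)
  qed
  finally show ?thesis .
qed

lemma finite_set_D1: "finite (set_pmf \<nu>) \<Longrightarrow> n \<ge> 1 \<Longrightarrow> finite (set_pmf (D1 k n \<nu>))"
  by (simp add: D1_def finite_set_D0)

lemma error_prob_conv_expectation:
  assumes "finite (set_pmf \<nu>)" "n \<ge> 1"
  shows "error_prob k n \<nu> P
    = (measure_pmf.expectation (D0 n \<nu>) (\<lambda>X. of_bool (run_output P X))
      + measure_pmf.expectation (D1 k n \<nu>) (\<lambda>X. of_bool (\<not> run_output P X))) / 2"
proof -
  have E: "measure_pmf.expectation (D k n \<nu>) h = (measure_pmf.expectation (D0 n \<nu>) (\<lambda>X. h (False, X))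
      + measure_pmf.expectation (D1 k n \<nu>) (\<lambda>X. h (True, X))) / 2" for h :: "bool \<times> input \<Rightarrow> real"
    unfolding D_def using assms
    by (simp add: expectation_bind_pmf_finite finite_set_D0 finite_set_D1 integral_pmf_of_set UNIV_bool)
  have "error_prob k n \<nu> P = measure_pmf.expectation (D k n \<nu>) (indicator {(b, X). run_output P X \<noteq> b})"
    by (simp add: error_prob_def)
  then show ?thesis unfolding E by (simp add: indicator_def of_bool_def)
qed

section \<open>The lower bound\<close>

theorem mainTheorem4:
  "\<exists>c::real. c > 0 \<and>
     (\<forall>n k (\<nu>::nat pmf) (cs::nat \<Rightarrow> nat) P.
        n \<ge> 1 \<longrightarrow> k \<ge> 2 \<longrightarrow> set_pmf \<nu> \<subseteq> {0..<k} \<longrightarrow>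
        protocol_bounded k n cs P \<longrightarrow> error_prob k n \<nu> P \<le> 2/100 \<longrightarrow>
        (\<Sum>i<k. ratio (cs i) (pmf \<nu> i)) \<ge> ennreal (c * real n))"
\<comment> \<open>The 4 comes from the information bound for one player, \<open>exp 2\<close> from
  merging blocks.\<close>
proof (intro exI[of _ "1 / (4 * exp 2)"] conjI allI impI)
  fix n k :: nat and \<nu> :: "nat pmf" and cs :: "nat \<Rightarrow> nat" and P
  assume n: "n \<ge> 1" and k: "k \<ge> 2" and \<nu>: "set_pmf \<nu> \<subseteq> {0..<k}"
    and bd: "protocol_bounded k n cs P" and err: "error_prob k n \<nu> P \<le> 2 / 100"
  have fin: "finite (set_pmf \<nu>)" using \<nu> finite_subset by blast
  let ?E = "measure_pmf.expectation (owners n \<nu>)"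
  have int: "integrable (owners n \<nu>) f" for f :: "(nat \<Rightarrow> nat) \<Rightarrow> real"
    by (rule integrable_measure_pmf_finite[OF finite_set_owners[OF fin]])
  have mono: "?E f \<le> ?E g" if "\<And>w. w \<in> set_pmf (owners n \<nu>) \<Longrightarrow> f w \<le> g w" for f g :: "(nat \<Rightarrow> nat) \<Rightarrow> real"
    using that by (intro integral_mono_AE int) (simp add: AE_measure_pmf_iff)
  have wk: "w j < k" if "w \<in> set_pmf (owners n \<nu>)" "j < n" for w j
    using owners_range[OF that] \<nu> by auto

  \<comment> \<open>Lower bound on the total Hellinger distance\<close>
  define \<alpha> where "\<alpha> w = (\<Sum>B\<in>Pow {..<n}. of_bool (run_output P (sparse_input w B))) / (2 ^ n :: real)" for w
  define a where "a w j = (\<Sum>B\<in>Pow {..<n}. of_bool (run_output P (planted w j {} B))) / (2 ^ n :: real)"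
    for w j
  define b where "b w j = (\<Sum>B\<in>Pow {..<n}. of_bool (\<not> run_output P (planted w j {..<k} B))) / (2 ^ n :: real)"
    for w j
  define h where "h i = (\<Sum>j<n. ?E (\<lambda>w. hellinger n P w j {i}))" for i

  \<comment> \<open>Emptying column \<open>j\<close> conditions \<open>B\<close> on missing
    \<open>j\<close>, an event of probability 1/2, so the error at most doubles.\<close>
  have a_le: "a w j \<le> 2 * \<alpha> w" if "j < n" for w j
  proof -
    define f where "f B = (of_bool (run_output P (sparse_input w B)) :: real)" for B
    have "(\<Sum>B\<in>Pow {..<n}. f (B - {j})) = 2 * (\<Sum>B\<in>Pow ({..<n} - {j}). f B)"
      using that by (intro sum_Pow_remove(1)) auto
    also have "(\<Sum>B\<in>Pow ({..<n} - {j}). f B) \<le> (\<Sum>B\<in>Pow {..<n}. f B)"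
      by (intro sum_mono2) (auto simp: f_def)
    finally have le: "(\<Sum>B\<in>Pow {..<n}. f (B - {j})) \<le> 2 * (\<Sum>B\<in>Pow {..<n}. f B)" by simp
    have "a w j = (\<Sum>B\<in>Pow {..<n}. f (B - {j})) / 2 ^ n"
      by (simp only: a_def f_def planted_empty)
    also have "\<dots> \<le> (2 * (\<Sum>B\<in>Pow {..<n}. f B)) / 2 ^ n"
      by (intro divide_right_mono le) simp
    also have "\<dots> = 2 * \<alpha> w" by (simp only: \<alpha>_def f_def times_divide_eq_right)
    finally show ?thesis .
  qed
  have err': "?E \<alpha> + ?E (\<lambda>w. \<Sum>j<n. b w j) / n \<le> 4 / 100"
  proof -
    have "measure_pmf.expectation (D0 n \<nu>) (\<lambda>X. of_bool (run_output P X)) = ?E \<alpha>"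
      unfolding expectation_D0[OF fin] \<alpha>_def ..
    moreover have "measure_pmf.expectation (D1 k n \<nu>) (\<lambda>X. of_bool (\<not> run_output P X))
        = ?E (\<lambda>w. (\<Sum>j<n. b w j) / n)"
      unfolding expectation_D1[OF fin n] b_def ..
    ultimately show ?thesis
      using err unfolding error_prob_conv_expectation[OF fin n] by simp
  qed
  \<comment> \<open>The subtracted term is at most \<open>4 * 2 * (4 / 100) * n\<close>, which is
    below \<open>n / 2\<close>.\<close>
  have "real n \<le> 3 / 2 * n - 4 * (2 * n * ?E \<alpha> + ?E (\<lambda>w. \<Sum>j<n. b w j))"
  proof -
    have "?E \<alpha> \<ge> 0" "?E (\<lambda>w. \<Sum>j<n. b w j) \<ge> 0"
      by (auto intro!: Bochner_Integration.integral_nonneg sum_nonneg simp: \<alpha>_def b_def)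
    moreover have "n * ?E \<alpha> + ?E (\<lambda>w. \<Sum>j<n. b w j) \<le> 4 / 100 * n"
      using err' n by (simp add: field_simps)
    ultimately show ?thesis by (simp add: field_simps)
  qed
  also have "\<dots> = ?E (\<lambda>w. 3 / 2 * n - 4 * (2 * n * \<alpha> w + (\<Sum>j<n. b w j)))"
    using int by simp
  also have "\<dots> \<le> ?E (\<lambda>w. \<Sum>j<n. hellinger n P w j {..<k})"
  proof (rule mono)
    fix w
    have "3 / 2 * n - 4 * (2 * n * \<alpha> w + (\<Sum>j<n. b w j)) = (\<Sum>j<n. 3 / 2 - 4 * (2 * \<alpha> w + b w j))"
      by (simp add: sum_subtractf sum.distrib sum_distrib_left algebra_simps)
    also have "\<dots> \<le> (\<Sum>j<n. hellinger n P w j {..<k})"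
    proof (rule sum_mono)
      fix j assume "j \<in> {..<n}"
      then show "3 / 2 - 4 * (2 * \<alpha> w + b w j) \<le> hellinger n P w j {..<k}"
        using hellinger_ge[where n = n and P = P and w = w and j = j and A = "{..<k}"] a_le[of j w] by (simp add: a_def b_def)
    qed
    finally show "3 / 2 * n - 4 * (2 * n * \<alpha> w + (\<Sum>j<n. b w j)) \<le> (\<Sum>j<n. hellinger n P w j {..<k})" .
  qed
  also have "\<dots> \<le> ?E (\<lambda>w. \<Sum>j<n. exp 2 * (\<Sum>i<k. hellinger n P w j {i}))"
    using k by (intro mono sum_mono hellinger_all_le) auto
  also have "\<dots> = exp 2 * (\<Sum>i<k. h i)"
    unfolding h_def using int by (subst sum.swap) (simp add: sum_distrib_left)
  finally have n_le: "n \<le> exp 2 * (\<Sum>i<k. h i)" .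

  \<comment> \<open>Upper bounds on the contribution of each player\<close>
  have h0: "h i \<ge> 0" for i
    unfolding h_def by (intro sum_nonneg Bochner_Integration.integral_nonneg) (simp add: hellinger_def sum_nonneg)
  \<comment> \<open>By independence the factor \<open>pmf \<nu> i\<close> becomes the event
    \<open>w j = i\<close>, which restricts the sum to the columns owned by player
    \<open>i\<close>.\<close>
  have h_le: "pmf \<nu> i * h i \<le> 4 * cs i" if i: "i < k" for i
  proof -
    have "pmf \<nu> i * h i = (\<Sum>j<n. ?E (\<lambda>w. of_bool (w j = i) * hellinger n P w j {i}))"
      unfolding h_def sum_distrib_left
      by (intro sum.cong refl expectation_owners_mult[symmetric] fin hellinger_cong) auto
    also have "\<dots> = ?E (\<lambda>w. \<Sum>j<n. of_bool (w j = i) * hellinger n P w j {i})"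
      by (rule Bochner_Integration.integral_sum[symmetric]) (rule int)
    also have "\<dots> \<le> ?E (\<lambda>_. 4 * cs i)"
    proof (rule mono)
      fix w assume w: "w \<in> set_pmf (owners n \<nu>)"
      have "(\<Sum>j<n. of_bool (w j = i) * hellinger n P w j {i}) = (\<Sum>j | j < n \<and> w j = i. hellinger n P w j {i})"
        by (intro sum.mono_neutral_cong_right) auto
      also have "\<dots> \<le> 4 * cs i"
        by (rule sum_hellinger_singleton_le[OF bd wk[OF w] i])
      finally show "(\<Sum>j<n. of_bool (w j = i) * hellinger n P w j {i}) \<le> 4 * cs i" .
    qed
    finally show ?thesis by simp
  qed
  have h_silent: "h i = 0" if "i < k" "cs i = 0" for i
  proof -
    have "?E (\<lambda>w. hellinger n P w j {i}) = 0" if j: "j < n" for j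
    proof (rule integral_eq_zero_AE, unfold AE_measure_pmf_iff, rule ballI)
      fix w assume "w \<in> set_pmf (owners n \<nu>)"
      then show "hellinger n P w j {i} = 0"
        by (intro hellinger_silent_player[OF bd wk \<open>i < k\<close> \<open>cs i = 0\<close> j])
    qed
    then show ?thesis by (simp add: h_def)
  qed
  \<comment> \<open>If \<open>pmf \<nu> i = 0\<close>, the ratio is infinite unless
    \<open>cs i = 0\<close>, and then \<open>h i = 0\<close> fits the convention 0/0 = 0.\<close>
  have "ennreal (h i / 4) \<le> ratio (cs i) (pmf \<nu> i)" if i: "i < k" for i
  proof (cases "pmf \<nu> i = 0")
    case True
    then show ?thesis using h_silent[OF i] by (simp add: ratio_def)
  next
    case False
    then have "pmf \<nu> i > 0" by (simp add: order.strict_iff_order)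
    then have "h i / 4 \<le> cs i / pmf \<nu> i" using h_le[OF i] by (simp add: field_simps)
    then show ?thesis using False by (simp add: ratio_def ennreal_leI)
  qed
  then have "(\<Sum>i<k. ennreal (h i / 4)) \<le> (\<Sum>i<k. ratio (cs i) (pmf \<nu> i))"
    by (intro sum_mono) auto
  moreover have "ennreal (1 / (4 * exp 2) * n) \<le> ennreal (\<Sum>i<k. h i / 4)"
    using n_le by (intro ennreal_leI) (simp add: field_simps flip: sum_divide_distrib)
  moreover have "ennreal (\<Sum>i<k. h i / 4) = (\<Sum>i<k. ennreal (h i / 4))"
    using h0 by (intro sum_ennreal[symmetric]) simp
  ultimately show "ennreal (1 / (4 * exp 2) * n) \<le> (\<Sum>i<k. ratio (cs i) (pmf \<nu> i))"
    by simp
qed simp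

end
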